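(* Let $(\gamma_+,\gamma_-)$ be an angularly regular parallel pair of cooriented frontal germs in $\mathbb{R}^2$ with common angular parameter $u$ near $0$, so that $\gamma_+'(u)=\rho_+(u)\mathbf e(u)$ and $\gamma_-'(u)=-\rho_-(u)\mathbf e(u)$, with $\gamma_+(0)\ne\gamma_-(0)$. Put $\Delta_\rho=\rho_+-\rho_-$ and $\mathrm E_{1/2}(u)=\frac12(\gamma_+(u)+\gamma_-(u))$. If $\mathrm E_{1/2}$ has a $3/2$-cusp at $0$, then its cuspidal curvature is $$\omega_{\mathrm E_{1/2}}=\frac{\det(\mathrm E_{1/2}''(0),\mathrm E_{1/2}'''(0))}{|\mathrm E_{1/2}''(0)|^{5/2}}=\frac{2\sqrt2}{\sqrt{|\Delta_\rho'(0)|}}.$$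
   Context: A smooth germ $\gamma:(\mathbb R,0)\to\mathbb R^2$ is a cooriented frontal if it has a smooth unit normal field $\mathbf n$ with $\gamma'\cdot\mathbf n=0$; choosing the unit tangent field $\mathbf e=(\cos\theta,\sin\theta)$ so that $(\mathbf e,\mathbf n)$ is positively oriented, $\gamma'=\ell\mathbf e$ with smooth $\ell,\theta$. It is angularly regular if $\theta'\neq0$. Angularly regular parallel pair: two angularly regular cooriented frontal germs $\gamma_\pm$ whose tangent lines at the base points are parallel, tangent lifts chosen opposite at the base points. Both are parametrised by a common angular parameter $u$ near $0$, with $\gamma_+'(u)=\rho_+(u)\mathbf e(u)$, $\gamma_-'(u)=-\rho_-(u)\mathbf e(u)$, where $\mathbf e(u)=(\cos(u+\theta_0),\sin(u+\theta_0))$ for a constant $\theta_0$, and $\rho_\pm$ are smooth (extended signed radii of curvature, possibly vanishing). Prime denotes $d/du$. A $3/2$-cusp is a germ that becomes $t\mapsto(t^2,t^3)$ after smooth diffeomorphism germs in source and target. For a germ $f:(\mathbb R,0)\to\mathbb R^2$ with $f'(0)=0$, $f''(0)\neq0$, the cuspidal curvature is $\omega_f=\det(f''(0),f'''(0))/|f''(0)|^{5/2}$. *)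

theory Defs
  imports "HOL-Analysis.Analysis"
begin

text \<open>Map germs are represented by total functions; only their values near the base point
  matter. All base points in the source line are \<open>0\<close>.\<close>

primrec Ck_on :: "nat \<Rightarrow> ('a::real_normed_vector \<Rightarrow> 'b::real_normed_vector) \<Rightarrow> 'a set \<Rightarrow> bool" where
  "Ck_on 0 f S \<longleftrightarrow> continuous_on S f"
| "Ck_on (Suc k) f S \<longleftrightarrow>
     (\<forall>x\<in>S. f differentiable (at x)) \<and> (\<forall>v. Ck_on k (\<lambda>x. frechet_derivative f (at x) v) S)"

text \<open>\<^const>\<open>Ck_on\<close> is used on open sets of finite-dimensional spaces only, where continuity of
  all iterated directional derivatives is the usual notion of being \<open>k\<close> times continuously
  differentiable.\<close>

definition smooth_germ :: "('a::real_normed_vector \<Rightarrow> 'b::real_normed_vector) \<Rightarrow> 'a \<Rightarrow> bool" where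
  "smooth_germ f a \<longleftrightarrow> (\<exists>S. open S \<and> a \<in> S \<and> (\<forall>k. Ck_on k f S))"

definition diffeo_germ ::
    "('a::real_normed_vector \<Rightarrow> 'b::real_normed_vector) \<Rightarrow> 'a \<Rightarrow> 'b \<Rightarrow> bool" where
  "diffeo_germ f a b \<longleftrightarrow> f a = b \<and> smooth_germ f a \<and>
     (\<exists>g. g b = a \<and> smooth_germ g b \<and>
          (\<forall>\<^sub>F x in nhds a. g (f x) = x) \<and> (\<forall>\<^sub>F y in nhds b. f (g y) = y))"

definition vderiv :: "(real \<Rightarrow> 'a::real_normed_vector) \<Rightarrow> real \<Rightarrow> 'a" where
  "vderiv f u = vector_derivative f (at u)"

definition unit_dir :: "real \<Rightarrow> real^2" where
  "unit_dir \<theta> = vector [cos \<theta>, sin \<theta>]"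

definition det2 :: "real^2 \<Rightarrow> real^2 \<Rightarrow> real" where
  "det2 v w = det (vector [v, w] :: real^2^2)"

text \<open>The coorientation is the unit normal field \<open>n\<close>; it is part of the data.\<close>

definition cooriented_frontal :: "(real \<Rightarrow> real^2) \<Rightarrow> (real \<Rightarrow> real^2) \<Rightarrow> bool" where
  "cooriented_frontal \<gamma> n \<longleftrightarrow> smooth_germ \<gamma> 0 \<and> smooth_germ n 0 \<and>
     (\<forall>\<^sub>F u in nhds 0. norm (n u) = 1 \<and> vderiv \<gamma> u \<bullet> n u = 0)"

text \<open>The unique unit vector \<open>e\<close> orthogonal to the unit vector \<open>v\<close> such that \<open>(e, v)\<close> is
  positively oriented, i.e. \<open>v\<close> rotated by \<open>-\<pi>/2\<close>.\<close>

definition tangent_lift :: "real^2 \<Rightarrow> real^2" where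
  "tangent_lift v = vector [v $ 2, - (v $ 1)]"

text \<open>The factorisation \<open>\<gamma>' = l e\<close> with \<open>l\<close> smooth is automatic (\<open>l = \<gamma>' \<bullet> e\<close>). Since the
  angle \<open>\<theta>\<close> is smooth, \<open>\<theta>' \<noteq> 0\<close> at \<open>0\<close> is the same as \<open>\<theta>' \<noteq> 0\<close> near \<open>0\<close>.\<close>

definition angularly_regular :: "(real \<Rightarrow> real^2) \<Rightarrow> (real \<Rightarrow> real^2) \<Rightarrow> bool" where
  "angularly_regular \<gamma> n \<longleftrightarrow> cooriented_frontal \<gamma> n \<and>
     (\<exists>\<theta>. smooth_germ \<theta> 0 \<and> (\<forall>\<^sub>F u in nhds 0. tangent_lift (n u) = unit_dir (\<theta> u)) \<and>
          deriv \<theta> 0 \<noteq> 0)"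

text \<open>Opposite tangent lifts at the base points make the two tangent lines parallel.\<close>

definition angularly_regular_parallel_pair ::
    "(real \<Rightarrow> real^2) \<Rightarrow> (real \<Rightarrow> real^2) \<Rightarrow> (real \<Rightarrow> real^2) \<Rightarrow> (real \<Rightarrow> real^2) \<Rightarrow> bool" where
  "angularly_regular_parallel_pair \<gamma>p np \<gamma>m nm \<longleftrightarrow>
     angularly_regular \<gamma>p np \<and> angularly_regular \<gamma>m nm \<and>
     tangent_lift (nm 0) = - tangent_lift (np 0)"

definition common_angular_parameter ::
    "(real \<Rightarrow> real^2) \<Rightarrow> (real \<Rightarrow> real^2) \<Rightarrow> (real \<Rightarrow> real^2) \<Rightarrow> (real \<Rightarrow> real^2) \<Rightarrow>
     real \<Rightarrow> (real \<Rightarrow> real) \<Rightarrow> (real \<Rightarrow> real) \<Rightarrow> bool" where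
  "common_angular_parameter \<gamma>p np \<gamma>m nm \<theta>0 \<rho>p \<rho>m \<longleftrightarrow>
     smooth_germ \<rho>p 0 \<and> smooth_germ \<rho>m 0 \<and>
     (\<forall>\<^sub>F u in nhds 0.
        tangent_lift (np u) = unit_dir (u + \<theta>0) \<and>
        tangent_lift (nm u) = - unit_dir (u + \<theta>0) \<and>
        vderiv \<gamma>p u = \<rho>p u *\<^sub>R unit_dir (u + \<theta>0) \<and>
        vderiv \<gamma>m u = - (\<rho>m u *\<^sub>R unit_dir (u + \<theta>0)))"

definition E_half :: "(real \<Rightarrow> real^2) \<Rightarrow> (real \<Rightarrow> real^2) \<Rightarrow> real \<Rightarrow> real^2" where
  "E_half \<gamma>p \<gamma>m u = (1/2) *\<^sub>R (\<gamma>p u + \<gamma>m u)"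

definition three_halves_cusp :: "(real \<Rightarrow> real^2) \<Rightarrow> bool" where
  "three_halves_cusp f \<longleftrightarrow> smooth_germ f 0 \<and>
     (\<exists>\<phi> \<Phi>. diffeo_germ \<phi> (0::real) (0::real) \<and> diffeo_germ \<Phi> (f 0) (0::real^2) \<and>
        (\<forall>\<^sub>F t in nhds 0. \<Phi> (f (\<phi> t)) = vector [t^2, t^3]))"

text \<open>Meaningful only if \<open>f'(0) = 0\<close> and \<open>f''(0) \<noteq> 0\<close>.\<close>

definition cuspidal_curvature :: "(real \<Rightarrow> real^2) \<Rightarrow> real" where
  "cuspidal_curvature f =
     det2 ((vderiv ^^ 2) f 0) ((vderiv ^^ 3) f 0) / norm ((vderiv ^^ 2) f 0) powr (5/2)"

end

theory Submission
  imports Defs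
begin

text \<open>A \<open>3/2\<close>-cusp has the form \<open>f = \<Psi> \<circ> (\<psi>\<^sup>2, \<psi>\<^sup>3)\<close> for diffeomorphism germs \<open>\<Psi>, \<psi>\<close>, so
  \<open>f'(0) = 0\<close>, while \<open>f(u) - f(0)\<close> cannot be \<open>o(u\<^sup>2)\<close> because the inverse \<open>\<Phi>\<close> of \<open>\<Psi>\<close> is Lipschitz
  at \<open>f(0)\<close>. Since \<open>E' = \<Delta>\<^sub>\<rho> e / 2\<close>, this forces \<open>\<Delta>\<^sub>\<rho>(0) = 0\<close> and \<open>\<Delta>\<^sub>\<rho>'(0) \<noteq> 0\<close>. Differentiating,
  \<open>E''(0) = \<Delta>\<^sub>\<rho>'(0) e / 2\<close> and \<open>E'''(0) = \<Delta>\<^sub>\<rho>''(0) e / 2 + \<Delta>\<^sub>\<rho>'(0) e'\<close>, whence the formula.\<close>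

section \<open>Smooth germs and their first two derivatives\<close>

lemma smooth_germ_eventually_differentiable:
  assumes "smooth_germ f a"
  shows "\<forall>\<^sub>F x in nhds a. f differentiable (at x)"
proof -
  from assms obtain S where S: "open S" "a \<in> S" and C: "\<forall>k. Ck_on k f S"
    by (auto simp: smooth_germ_def)
  from C have "Ck_on (Suc 0) f S" by blast
  with S show ?thesis by (auto simp: eventually_nhds)
qed

lemma smooth_germ_differentiable:
  "smooth_germ f a \<Longrightarrow> f differentiable (at a)"
  using eventually_nhds_x_imp_x[OF smooth_germ_eventually_differentiable] .

lemma smooth_germ_deriv:
  fixes f :: "real \<Rightarrow> real"
  assumes "smooth_germ f a"
  shows "\<forall>\<^sub>F x in nhds a. (f has_real_derivative deriv f x) (at x)"
  using smooth_germ_eventually_differentiable[OF assms]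
  by eventually_elim (metis DERIV_imp_deriv real_differentiableE)

text \<open>\<open>Ck_on\<close> controls directional derivatives. In direction 1 these coincide
  with \<open>deriv f\<close> on the whole open set \<open>S\<close>, so differentiability carries
  over to \<open>deriv f\<close>.\<close>

lemma smooth_germ_deriv2:
  fixes f :: "real \<Rightarrow> real"
  assumes "smooth_germ f a"
  shows "\<forall>\<^sub>F x in nhds a. (deriv f has_real_derivative deriv (deriv f) x) (at x)"
proof -
  from assms obtain S where S: "open S" "a \<in> S" and C: "\<forall>k. Ck_on k f S"
    by (auto simp: smooth_germ_def)
  have C2: "Ck_on (Suc (Suc 0)) f S" using C by blast
  have eq: "frechet_derivative f (at x) 1 = deriv f x" if "x \<in> S" for x
  proof -
    have "f differentiable (at x)" using C2 that by simp
    then obtain D where D: "(f has_real_derivative D) (at x)"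
      by (metis real_differentiableE)
    have "frechet_derivative f (at x) = (*) D"
      using D by (metis frechet_derivative_at has_field_derivative_def)
    then show ?thesis using D by (simp add: DERIV_imp_deriv)
  qed
  have "(deriv f has_real_derivative deriv (deriv f) x) (at x)" if x: "x \<in> S" for x
  proof -
    have "(\<lambda>x. frechet_derivative f (at x) 1) differentiable (at x)" using C2 x by simp
    then obtain D where "((\<lambda>x. frechet_derivative f (at x) 1) has_real_derivative D) (at x)"
      by (metis real_differentiableE)
    then have "(deriv f has_real_derivative D) (at x)"
      by (rule has_field_derivative_transform_within_open[OF _ S(1) x]) (simp add: eq)
    then show ?thesis by (simp add: DERIV_imp_deriv)
  qed
  with S show ?thesis by (auto simp: eventually_nhds)
qed

section \<open>Derivatives of germs that agree near a point\<close>

lemma has_vector_derivative_cong_nhds: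
  assumes "\<forall>\<^sub>F x in nhds u. f x = g x"
  shows "(f has_vector_derivative D) (at u) \<longleftrightarrow> (g has_vector_derivative D) (at u)"
proof (rule has_vector_derivative_cong_ev)
  show "\<forall>\<^sub>F x in nhds u. x \<in> UNIV \<longrightarrow> f x = g x" using assms by simp
  show "f u = g u" using assms by (rule eventually_nhds_x_imp_x)
qed

text \<open>Agreement near \<open>a\<close> is also agreement near every point close to
  \<open>a\<close>, so derivatives agree there too. The conclusion has the form of the first
  assumption, which allows iteration to higher derivatives.\<close>

lemma eventually_vderiv:
  assumes "\<forall>\<^sub>F u in nhds a. f u = g u"
    and "\<forall>\<^sub>F u in nhds a. (g has_vector_derivative g' u) (at u)"
  shows "\<forall>\<^sub>F u in nhds a. vderiv f u = g' u"
proof -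
  have "\<forall>\<^sub>F u in nhds a. \<forall>\<^sub>F x in nhds u. f x = g x"
    using assms(1) by (simp add: eventually_eventually)
  with assms(2) show ?thesis
  proof eventually_elim
    case (elim u)
    have "(f has_vector_derivative g' u) (at u)"
      using elim by (simp add: has_vector_derivative_cong_nhds)
    then show ?case by (simp add: vderiv_def vector_derivative_at)
  qed
qed

section \<open>Cusps of type 3/2: vanishing velocity and non-flatness\<close>

text \<open>The chain rule applied to \<open>\<phi> (\<psi> y) = y\<close> makes the two derivatives
  reciprocal, hence nonzero.\<close>

lemma diffeo_germ_real_inverse:
  fixes \<phi> :: "real \<Rightarrow> real"
  assumes "diffeo_germ \<phi> 0 0"
  obtains \<psi> c where "\<psi> 0 = 0" "c \<noteq> 0" "(\<psi> has_real_derivative c) (at 0)"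
    "\<forall>\<^sub>F y in nhds 0. \<phi> (\<psi> y) = y"
proof -
  from assms obtain \<psi> where psi: "\<psi> 0 = 0" "smooth_germ \<psi> 0" "\<forall>\<^sub>F y in nhds 0. \<phi> (\<psi> y) = y"
    and phi: "smooth_germ \<phi> 0"
    by (auto simp: diffeo_germ_def)
  obtain b c where b: "(\<phi> has_real_derivative b) (at (\<psi> 0))" and c: "(\<psi> has_real_derivative c) (at 0)"
    using smooth_germ_differentiable[OF phi] smooth_germ_differentiable[OF psi(2)] psi(1)
    by (metis real_differentiableE)
  have "((\<lambda>y. \<phi> (\<psi> y)) has_real_derivative b * c) (at 0)"
    using DERIV_chain2[OF b c] .
  moreover have "((\<lambda>y. \<phi> (\<psi> y)) has_real_derivative 1) (at 0)"
    using psi(3) DERIV_ident by (subst DERIV_cong_ev[OF refl _ refl])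
  ultimately have "b * c = 1" by (rule DERIV_unique)
  then have "c \<noteq> 0" by auto
  then show ?thesis using that psi c by blast
qed

text \<open>The linear part is bounded, and tolerance 1 in the definition of the derivative adds one
  more \<open>norm (y - a)\<close>; this gives the constant \<open>K + 1\<close> below.\<close>

lemma has_derivative_eventually_norm_le:
  assumes "(f has_derivative D) (at a)"
  obtains K where "K > 0" "\<forall>\<^sub>F y in nhds a. norm (f y - f a) \<le> K * norm (y - a)"
proof -
  have "bounded_linear D" using assms by (rule has_derivative_bounded_linear)
  then obtain K where K: "K > 0" "\<And>x. norm (D x) \<le> norm x * K"
    using bounded_linear.pos_bounded by blast
  obtain d where d: "d > 0"
    "\<And>y. norm (y - a) < d \<Longrightarrow> norm (f y - f a - D (y - a)) \<le> 1 * norm (y - a)"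
    using assms unfolding has_derivative_at_alt by (meson zero_less_one)
  have "norm (f y - f a) \<le> (K + 1) * norm (y - a)" if "dist y a < d" for y
  proof -
    have "norm (f y - f a) \<le> norm (f y - f a - D (y - a)) + norm (D (y - a))"
      by (metis norm_triangle_sub add.commute)
    also have "\<dots> \<le> 1 * norm (y - a) + norm (y - a) * K"
      using d(2)[of y] K(2)[of "y - a"] that by (intro add_mono) (auto simp: dist_norm)
    finally show ?thesis by (simp add: algebra_simps)
  qed
  then have "\<forall>\<^sub>F y in nhds a. norm (f y - f a) \<le> (K + 1) * norm (y - a)"
    using d(1) by (auto simp: eventually_nhds_metric)
  then show ?thesis using that[of "K + 1"] K(1) by simp
qed

text \<open>Written as a linear combination, a vector of coordinates is open to the derivative rules
  for sums and scalings.\<close>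

lemma vector2_eq_axis: "vector [x, y] = x *\<^sub>R axis 1 1 + y *\<^sub>R (axis 2 1 :: real^2)"
  by (simp add: vec_eq_iff forall_2 axis_def)

text \<open>Substituting \<open>t = \<psi> u\<close> moves the change of parameter from
  \<open>f\<close> to the model cusp. Since \<open>c \<noteq> 0\<close>, the new parameter
  \<open>\<psi> u\<close> has the same order of magnitude as \<open>u\<close>.\<close>

lemma three_halves_cusp_inverse_parameter:
  assumes "three_halves_cusp f"
  obtains \<Phi> \<psi> c where "diffeo_germ \<Phi> (f 0) (0::real^2)" "\<psi> 0 = (0::real)" "c \<noteq> 0"
    "(\<psi> has_real_derivative c) (at 0)"
    "\<forall>\<^sub>F u in nhds 0. \<Phi> (f u) = vector [(\<psi> u)\<^sup>2, (\<psi> u)^3]"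
proof -
  from assms obtain \<phi> \<Phi> where phi: "diffeo_germ \<phi> (0::real) (0::real)"
    and Phi: "diffeo_germ \<Phi> (f 0) (0::real^2)"
    and eq: "\<forall>\<^sub>F t in nhds 0. \<Phi> (f (\<phi> t)) = vector [t^2, t^3]"
    by (auto simp: three_halves_cusp_def)
  obtain \<psi> c where psi: "\<psi> 0 = 0" "c \<noteq> 0" "(\<psi> has_real_derivative c) (at 0)"
    "\<forall>\<^sub>F y in nhds 0. \<phi> (\<psi> y) = y"
    using diffeo_germ_real_inverse[OF phi] .
  have "filterlim \<psi> (nhds 0) (nhds 0)"
    using DERIV_isCont[OF psi(3)] psi(1) by (metis isContD tendsto_at_iff_tendsto_nhds)
  then have "\<forall>\<^sub>F u in nhds 0. \<Phi> (f (\<phi> (\<psi> u))) = vector [(\<psi> u)^2, (\<psi> u)^3]"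
    using eq filterlim_iff by fast
  with psi(4) have "\<forall>\<^sub>F u in nhds 0. \<Phi> (f u) = vector [(\<psi> u)^2, (\<psi> u)^3]"
    by eventually_elim simp
  then show ?thesis using that Phi psi by blast
qed

lemma smooth_germ_tendsto_nhds:
  "smooth_germ f a \<Longrightarrow> filterlim f (nhds (f a)) (nhds a)"
  using differentiable_imp_continuous_within[OF smooth_germ_differentiable]
  by (metis continuous_within tendsto_at_iff_tendsto_nhds)

text \<open>Near 0, \<open>f\<close> is a local inverse of \<open>\<Phi>\<close> composed with the
  curve of coordinates \<open>\<psi>^2\<close> and \<open>\<psi>^3\<close>. That curve has zero
  velocity at 0 because \<open>\<psi> 0 = 0\<close>, and the chain rule preserves this.\<close>

lemma three_halves_cusp_has_vector_derivative_0:
  assumes "three_halves_cusp f"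
  shows "(f has_vector_derivative 0) (at 0)"
proof -
  obtain \<Phi> \<psi> c where Phi: "diffeo_germ \<Phi> (f 0) (0::real^2)"
    and psi: "\<psi> 0 = (0::real)" "(\<psi> has_real_derivative c) (at 0)"
    and eq: "\<forall>\<^sub>F u in nhds 0. \<Phi> (f u) = vector [(\<psi> u)\<^sup>2, (\<psi> u)^3]"
    using three_halves_cusp_inverse_parameter[OF assms] .
  from Phi obtain \<Psi> where Psi: "smooth_germ \<Psi> 0" "\<forall>\<^sub>F x in nhds (f 0). \<Psi> (\<Phi> x) = x"
    by (auto simp: diffeo_germ_def)
  let ?h = "\<lambda>u. (\<psi> u)\<^sup>2 *\<^sub>R axis 1 1 + (\<psi> u)^3 *\<^sub>R (axis 2 1 :: real^2)"
  have "filterlim f (nhds (f 0)) (nhds 0)"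
    using assms smooth_germ_tendsto_nhds by (auto simp: three_halves_cusp_def)
  then have "\<forall>\<^sub>F u in nhds 0. \<Psi> (\<Phi> (f u)) = f u"
    using Psi(2) filterlim_iff by fast
  with eq have ev: "\<forall>\<^sub>F u in nhds 0. f u = \<Psi> (?h u)"
    by eventually_elim (simp flip: vector2_eq_axis)
  have h: "(?h has_vector_derivative 0) (at 0)"
    using psi by (auto intro!: derivative_eq_intros simp: has_vector_derivative_def
        has_field_derivative_def power2_eq_square power3_eq_cube)
  obtain D where D: "(\<Psi> has_derivative D) (at (?h 0))"
    using smooth_germ_differentiable[OF Psi(1)] psi(1) by (auto simp: differentiable_def)
  have "((\<lambda>u. \<Psi> (?h u)) has_derivative (\<lambda>x. D (x *\<^sub>R 0))) (at 0)"
    using has_derivative_compose[OF h[unfolded has_vector_derivative_def] D] .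
  moreover have "D 0 = 0"
    using has_derivative_bounded_linear[OF D] by (rule linear_simps(3))
  ultimately have "((\<lambda>u. \<Psi> (?h u)) has_vector_derivative 0) (at 0)"
    by (simp add: has_vector_derivative_def)
  then show ?thesis
    by (simp add: has_vector_derivative_cong_nhds[OF ev])
qed

text \<open>The first coordinate of \<open>\<Phi> (f u)\<close> is \<open>(\<psi> u)^2\<close>,
  which behaves like \<open>c^2 * u^2\<close>. The Lipschitz bound for \<open>\<Phi>\<close> at
  \<open>f 0\<close> passes this quadratic growth on to \<open>f u - f 0\<close>.\<close>

lemma three_halves_cusp_not_flat:
  assumes cusp: "three_halves_cusp f"
    and flat: "\<And>\<epsilon>. \<epsilon> > 0 \<Longrightarrow> \<forall>\<^sub>F u in nhds 0. norm (f u - f 0) \<le> \<epsilon> * u\<^sup>2"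
  shows False
proof -
  obtain \<Phi> \<psi> c where Phi: "diffeo_germ \<Phi> (f 0) (0::real^2)"
    and psi: "\<psi> 0 = (0::real)" "c \<noteq> 0" "(\<psi> has_real_derivative c) (at 0)"
    and eq: "\<forall>\<^sub>F u in nhds 0. \<Phi> (f u) = vector [(\<psi> u)\<^sup>2, (\<psi> u)^3]"
    using three_halves_cusp_inverse_parameter[OF cusp] .
  from Phi have "smooth_germ \<Phi> (f 0)" and Phi0: "\<Phi> (f 0) = 0"
    by (auto simp: diffeo_germ_def)
  then obtain D where D: "(\<Phi> has_derivative D) (at (f 0))"
    using smooth_germ_differentiable by (auto simp: differentiable_def)
  obtain K where K: "K > 0" "\<forall>\<^sub>F y in nhds (f 0). norm (\<Phi> y) \<le> K * norm (y - f 0)"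
    using has_derivative_eventually_norm_le[OF D] unfolding Phi0 diff_zero .
  have "filterlim f (nhds (f 0)) (nhds 0)"
    using cusp smooth_germ_tendsto_nhds by (auto simp: three_halves_cusp_def)
  then have lip: "\<forall>\<^sub>F u in nhds 0. norm (\<Phi> (f u)) \<le> K * norm (f u - f 0)"
    using K(2) filterlim_iff by fast
  have lim: "((\<lambda>u. (\<psi> u / u)\<^sup>2) \<longlongrightarrow> c\<^sup>2) (at 0)"
    using psi by (intro tendsto_power) (simp add: DERIV_def)
  \<comment> \<open>After multiplication by the Lipschitz constant \<open>K\<close>, this choice of
    \<epsilon> leaves half of the limit \<open>c^2\<close>, which is too small.\<close>
  have "\<forall>\<^sub>F u in nhds 0. norm (f u - f 0) \<le> (c\<^sup>2 / (2 * K)) * u\<^sup>2"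
    using K(1) psi(2) by (intro flat) simp
  with lip eq have "\<forall>\<^sub>F u in nhds 0. (\<psi> u)\<^sup>2 \<le> c\<^sup>2 / 2 * u\<^sup>2"
  proof eventually_elim
    case (elim u)
    have "(\<psi> u)\<^sup>2 \<le> norm (\<Phi> (f u))"
      using component_le_norm_cart[of "\<Phi> (f u)" 1] elim(2) by simp
    also have "\<dots> \<le> K * ((c\<^sup>2 / (2 * K)) * u\<^sup>2)"
      using elim(1,3) K(1) by (meson mult_left_mono less_imp_le order_trans)
    also have "\<dots> = c\<^sup>2 / 2 * u\<^sup>2" using K(1) by simp
    finally show ?case .
  qed
  \<comment> \<open>Dividing by \<open>u\<close> requires \<open>u \<noteq> 0\<close>, hence the
    passage to the punctured filter.\<close>
  then have "\<forall>\<^sub>F u in at 0. (\<psi> u)\<^sup>2 \<le> c\<^sup>2 / 2 * u\<^sup>2"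
    by (simp add: eventually_nhds_conv_at)
  then have "\<forall>\<^sub>F u in at 0. (\<psi> u / u)\<^sup>2 \<le> c\<^sup>2 / 2"
    using eventually_neq_at_within[of 0 0 UNIV]
    by eventually_elim (simp add: power_divide divide_le_eq)
  then have "c\<^sup>2 \<le> c\<^sup>2 / 2"
    by (rule tendsto_upperbound[OF lim]) simp
  with psi(2) show False by simp
qed

text \<open>This is the mean value inequality between 0 and \<open>u\<close>, where the derivative
  is bounded by \<open>\<epsilon> * \<bar>u\<bar>\<close>.\<close>

lemma flat_if_derivative_flat:
  fixes f :: "real \<Rightarrow> 'a::real_normed_vector"
  assumes der: "\<forall>\<^sub>F u in nhds 0. (f has_vector_derivative f' u) (at u)"
    and f': "\<forall>\<^sub>F u in nhds 0. norm (f' u) \<le> \<epsilon> * \<bar>u\<bar>" and "\<epsilon> \<ge> 0"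
  shows "\<forall>\<^sub>F u in nhds 0. norm (f u - f 0) \<le> \<epsilon> * u\<^sup>2"
proof -
  obtain d where d: "d > 0"
    "\<And>u. dist u 0 < d \<Longrightarrow> (f has_vector_derivative f' u) (at u) \<and> norm (f' u) \<le> \<epsilon> * \<bar>u\<bar>"
    using eventually_conj[OF der f'] by (auto simp: eventually_nhds_metric)
  have "norm (f u - f 0) \<le> \<epsilon> * u\<^sup>2" if u: "dist u 0 < d" for u
  proof -
    \<comment> \<open>A ball centred at 0 is convex and contains both 0 and \<open>u\<close>,
      whatever the sign of \<open>u\<close>.\<close>
    let ?S = "cball 0 \<bar>u\<bar> :: real set"
    have "norm (f u - f 0) \<le> (\<epsilon> * \<bar>u\<bar>) * norm (u - 0)"
    proof (rule differentiable_bound[of ?S f "\<lambda>x t. t *\<^sub>R f' x"])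
      fix x assume x: "x \<in> ?S"
      then have x': "dist x 0 < d" using u by simp
      then have "(f has_vector_derivative f' x) (at x)" using d(2) by blast
      then show "(f has_derivative (\<lambda>t. t *\<^sub>R f' x)) (at x within ?S)"
        unfolding has_vector_derivative_def by (rule has_derivative_at_withinI)
      have "norm (f' x) \<le> \<epsilon> * \<bar>x\<bar>" using d(2) x' by blast
      also have "\<dots> \<le> \<epsilon> * \<bar>u\<bar>" using x \<open>\<epsilon> \<ge> 0\<close> by (intro mult_left_mono) auto
      finally show "onorm (\<lambda>t. t *\<^sub>R f' x) \<le> \<epsilon> * \<bar>u\<bar>"
        by (intro onorm_bound) (auto simp: \<open>\<epsilon> \<ge> 0\<close> mult.commute mult_left_mono)
    qed auto
    then show ?thesis by (simp add: power2_eq_square mult.assoc)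
  qed
  then show ?thesis using d(1) by (auto simp: eventually_nhds_metric)
qed

section \<open>The rotating frame and curves given by their angle\<close>

lemma norm_unit_dir [simp]: "norm (unit_dir \<theta>) = 1"
  by (simp add: unit_dir_def norm_vec_def L2_set_def sum_2)

text \<open>Stating the derivative as a quarter turn, rather than in coordinates, lets the same rule
  differentiate the normal direction.\<close>

lemma has_vector_derivative_unit_dir:
  "((\<lambda>u. unit_dir (u + \<theta>)) has_vector_derivative unit_dir (u + \<theta> + pi/2)) (at u)"
proof -
  have "((\<lambda>u. cos (u + \<theta>) *\<^sub>R axis 1 1 + sin (u + \<theta>) *\<^sub>R (axis 2 1 :: real^2)) has_vector_derivative
      - sin (u + \<theta>) *\<^sub>R axis 1 1 + cos (u + \<theta>) *\<^sub>R axis 2 1) (at u)"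
    by (auto intro!: derivative_eq_intros simp: has_vector_derivative_def algebra_simps)
  then show ?thesis
    by (simp add: unit_dir_def vector2_eq_axis cos_add sin_add)
qed

lemma unit_dir_add_pi: "unit_dir (\<theta> + pi/2 + pi/2) = - unit_dir \<theta>"
  by (simp add: unit_dir_def vector2_eq_axis cos_add sin_add)

text \<open>The two directions form a positively oriented orthonormal basis, and the component
  \<open>b\<close> parallel to the first vector drops out of the determinant.\<close>

lemma det2_unit_dir:
  "det2 (a *\<^sub>R unit_dir \<theta>) (b *\<^sub>R unit_dir \<theta> + c *\<^sub>R unit_dir (\<theta> + pi/2)) = a * c"
proof -
  have "det2 (a *\<^sub>R unit_dir \<theta>) (b *\<^sub>R unit_dir \<theta> + c *\<^sub>R unit_dir (\<theta> + pi/2))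
      = a * c * ((sin \<theta>)\<^sup>2 + (cos \<theta>)\<^sup>2)"
    by (simp add: det2_def det_2 unit_dir_def cos_add sin_add power2_eq_square algebra_simps
        del: sin_cos_squared_add sin_cos_squared_add2 sin_cos_squared_add3)
  then show ?thesis by simp
qed

text \<open>With \<open>e\<close> the unit direction and \<open>n\<close> its quarter turn, this is
  the product rule with \<open>e' = n\<close> and \<open>n' = -e\<close>, applied to
  \<open>E' = r e\<close>. The assumptions hold near 0 so that each derivative is known on a
  neighbourhood before the next one is taken.\<close>

lemma vderiv_of_angular_parameter:
  fixes E :: "real \<Rightarrow> real^2" and r :: "real \<Rightarrow> real"
  assumes E: "\<forall>\<^sub>F u in nhds 0. (E has_vector_derivative r u *\<^sub>R unit_dir (u + \<theta>)) (at u)"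
    and r: "\<forall>\<^sub>F u in nhds 0. (r has_real_derivative r1 u) (at u)"
    and r1: "\<forall>\<^sub>F u in nhds 0. (r1 has_real_derivative r2 u) (at u)"
  shows "vderiv E 0 = r 0 *\<^sub>R unit_dir \<theta>"
    and "(vderiv ^^ 2) E 0 = r1 0 *\<^sub>R unit_dir \<theta> + r 0 *\<^sub>R unit_dir (\<theta> + pi/2)"
    and "(vderiv ^^ 3) E 0 =
      (r2 0 - r 0) *\<^sub>R unit_dir \<theta> + (2 * r1 0) *\<^sub>R unit_dir (\<theta> + pi/2)"
proof -
  let ?e = "\<lambda>u. unit_dir (u + \<theta>)" and ?n = "\<lambda>u. unit_dir (u + \<theta> + pi/2)"
  have e: "(?e has_vector_derivative ?n u) (at u)" for u
    by (rule has_vector_derivative_unit_dir)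
  \<comment> \<open>Differentiating a direction already turned by \<open>pi/2\<close> turns it
    again, and two quarter turns are the negation.\<close>
  have n: "(?n has_vector_derivative - ?e u) (at u)" for u
    using has_vector_derivative_unit_dir[of "\<theta> + pi/2" u]
    by (simp only: add.assoc[symmetric] unit_dir_add_pi)
  have E1: "\<forall>\<^sub>F u in nhds 0. vderiv E u = r u *\<^sub>R ?e u"
    using eventually_vderiv[OF _ E] by simp
  have "\<forall>\<^sub>F u in nhds 0. ((\<lambda>u. r u *\<^sub>R ?e u) has_vector_derivative r1 u *\<^sub>R ?e u + r u *\<^sub>R ?n u) (at u)"
    using r
  proof eventually_elim
    case (elim u)
    show ?case using has_vector_derivative_scaleR[OF elim e] by (simp add: add.commute)
  qed
  from eventually_vderiv[OF E1 this]
  have E2: "\<forall>\<^sub>F u in nhds 0. vderiv (vderiv E) u = r1 u *\<^sub>R ?e u + r u *\<^sub>R ?n u" .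
  have "\<forall>\<^sub>F u in nhds 0. ((\<lambda>u. r1 u *\<^sub>R ?e u + r u *\<^sub>R ?n u) has_vector_derivative
      (r2 u - r u) *\<^sub>R ?e u + (2 * r1 u) *\<^sub>R ?n u) (at u)"
    using r r1
  proof eventually_elim
    case (elim u)
    show ?case
      using has_vector_derivative_add[OF has_vector_derivative_scaleR[OF elim(2) e]
          has_vector_derivative_scaleR[OF elim(1) n]]
      by (simp add: algebra_simps scaleR_2 flip: scaleR_scaleR)
  qed
  from eventually_vderiv[OF E2 this]
  have E3: "\<forall>\<^sub>F u in nhds 0. vderiv (vderiv (vderiv E)) u =
      (r2 u - r u) *\<^sub>R ?e u + (2 * r1 u) *\<^sub>R ?n u" .
  show "vderiv E 0 = r 0 *\<^sub>R unit_dir \<theta>"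
    using eventually_nhds_x_imp_x[OF E1] by simp
  show "(vderiv ^^ 2) E 0 = r1 0 *\<^sub>R unit_dir \<theta> + r 0 *\<^sub>R unit_dir (\<theta> + pi/2)"
    using eventually_nhds_x_imp_x[OF E2] by (simp add: eval_nat_numeral)
  show "(vderiv ^^ 3) E 0 =
      (r2 0 - r 0) *\<^sub>R unit_dir \<theta> + (2 * r1 0) *\<^sub>R unit_dir (\<theta> + pi/2)"
    using eventually_nhds_x_imp_x[OF E3] by (simp add: eval_nat_numeral)
qed

section \<open>The cuspidal curvature of the midpoint curve\<close>

text \<open>The numerator is \<open>2 * x^2\<close> for \<open>x = \<bar>d/2\<bar>\<close>, so the
  sign of \<open>d\<close> disappears and the quotient reduces to \<open>2 / sqrt x\<close>.\<close>

lemma curvature_quotient: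
  fixes d :: real
  assumes "d \<noteq> 0"
  shows "(d/2) * d / \<bar>d/2\<bar> powr (5/2) = 2 * sqrt 2 / sqrt \<bar>d\<bar>"
proof -
  define x where "x = \<bar>d/2\<bar>"
  have x: "x > 0" using assms by (simp add: x_def)
  have "x powr (5/2) = x powr (2 + 1/2)" by simp
  also have "\<dots> = x\<^sup>2 * sqrt x"
    using x by (subst powr_add) (simp add: powr_half_sqrt)
  finally have p: "x powr (5/2) = x\<^sup>2 * sqrt x" .
  have "(d/2) * d = 2 * x\<^sup>2" by (simp add: x_def power_divide power2_eq_square)
  then have "(d/2) * d / x powr (5/2) = 2 / sqrt x" using p x by simp
  moreover have "sqrt x = sqrt \<bar>d\<bar> / sqrt 2" by (simp add: x_def real_sqrt_divide)
  ultimately show ?thesis by (simp add: x_def)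
qed

theorem proposition3p5:
  fixes \<gamma>p \<gamma>m np nm :: "real \<Rightarrow> real^2" and \<theta>0 :: real and \<rho>p \<rho>m :: "real \<Rightarrow> real"
  defines "E \<equiv> E_half \<gamma>p \<gamma>m"
    and "\<Delta>\<rho> \<equiv> (\<lambda>u. \<rho>p u - \<rho>m u)"
  assumes "angularly_regular_parallel_pair \<gamma>p np \<gamma>m nm"
    and "common_angular_parameter \<gamma>p np \<gamma>m nm \<theta>0 \<rho>p \<rho>m"
    and "\<gamma>p 0 \<noteq> \<gamma>m 0"
    and "three_halves_cusp E"
  shows "vderiv E 0 = 0 \<and> (vderiv ^^ 2) E 0 \<noteq> 0 \<and>
    cuspidal_curvature E =
      det2 ((vderiv ^^ 2) E 0) ((vderiv ^^ 3) E 0) / norm ((vderiv ^^ 2) E 0) powr (5/2) \<and>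
    det2 ((vderiv ^^ 2) E 0) ((vderiv ^^ 3) E 0) / norm ((vderiv ^^ 2) E 0) powr (5/2) =
      2 * sqrt 2 / sqrt \<bar>deriv \<Delta>\<rho> 0\<bar>"
proof -
  \<comment> \<open>The signed speed of \<open>E\<close> along the common direction: the minus sign
    in the derivative of \<open>\<gamma>m\<close> produces a difference, and the midpoint produces
    the factor 1/2.\<close>
  define r where "r = (\<lambda>u. \<Delta>\<rho> u / 2)"
  define d where "d = deriv \<Delta>\<rho> 0"
  have germs: "smooth_germ \<gamma>p 0" "smooth_germ \<gamma>m 0"
    using assms(3) by (auto simp: angularly_regular_parallel_pair_def angularly_regular_def
        cooriented_frontal_def)
  have rho: "smooth_germ \<rho>p 0" "smooth_germ \<rho>m 0"
    and ev: "\<forall>\<^sub>F u in nhds 0. vderiv \<gamma>p u = \<rho>p u *\<^sub>R unit_dir (u + \<theta>0) \<and>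
        vderiv \<gamma>m u = - (\<rho>m u *\<^sub>R unit_dir (u + \<theta>0))"
    using assms(4) by (auto simp: common_angular_parameter_def elim: eventually_mono)
  have E: "\<forall>\<^sub>F u in nhds 0. (E has_vector_derivative r u *\<^sub>R unit_dir (u + \<theta>0)) (at u)"
    using ev germs[THEN smooth_germ_eventually_differentiable]
  proof eventually_elim
    case (elim u)
    have p: "(\<gamma>p has_vector_derivative \<rho>p u *\<^sub>R unit_dir (u + \<theta>0)) (at u)"
      using elim by (metis vderiv_def vector_derivative_works)
    have m: "(\<gamma>m has_vector_derivative - (\<rho>m u *\<^sub>R unit_dir (u + \<theta>0))) (at u)"
      using elim by (metis vderiv_def vector_derivative_works)
    have "((\<lambda>u. (1/2) *\<^sub>R (\<gamma>p u + \<gamma>m u)) has_vector_derivative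
        (1/2) *\<^sub>R (\<rho>p u *\<^sub>R unit_dir (u + \<theta>0) + - (\<rho>m u *\<^sub>R unit_dir (u + \<theta>0)))) (at u)"
      by (rule bounded_linear.has_vector_derivative[OF bounded_linear_scaleR_right
            has_vector_derivative_add[OF p m]])
    moreover have "E = (\<lambda>u. (1/2) *\<^sub>R (\<gamma>p u + \<gamma>m u))"
      by (simp add: E_def E_half_def fun_eq_iff)
    ultimately show ?case
      by (simp add: r_def \<Delta>\<rho>_def diff_divide_distrib algebra_simps)
  qed
  \<comment> \<open>The derivatives of \<open>r\<close> are assembled from those of
    \<open>\<rho>p\<close> and \<open>\<rho>m\<close>, whose smoothness is given; the link with
    \<open>deriv \<Delta>\<rho>\<close> is needed at 0 only.\<close>
  define r1 where "r1 = (\<lambda>u. (deriv \<rho>p u - deriv \<rho>m u) / 2)"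
  define r2 where "r2 = (\<lambda>u. (deriv (deriv \<rho>p) u - deriv (deriv \<rho>m) u) / 2)"
  have r: "\<forall>\<^sub>F u in nhds 0. (r has_real_derivative r1 u) (at u)"
    using rho[THEN smooth_germ_deriv] unfolding r_def r1_def \<Delta>\<rho>_def
    by eventually_elim (auto intro!: derivative_eq_intros)
  have r1: "\<forall>\<^sub>F u in nhds 0. (r1 has_real_derivative r2 u) (at u)"
    using rho[THEN smooth_germ_deriv2] unfolding r1_def r2_def
    by eventually_elim (auto intro!: derivative_eq_intros)
  have d: "d = 2 * r1 0"
  proof -
    have "(\<Delta>\<rho> has_real_derivative 2 * r1 0) (at 0)"
      using rho[THEN smooth_germ_deriv, THEN eventually_nhds_x_imp_x] unfolding r1_def \<Delta>\<rho>_def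
      by (auto intro!: derivative_eq_intros)
    then show ?thesis by (simp add: d_def DERIV_imp_deriv)
  qed
  note vd = vderiv_of_angular_parameter[OF E r r1]
  have E0: "vderiv E 0 = 0"
    using three_halves_cusp_has_vector_derivative_0[OF assms(6)]
    by (simp add: vderiv_def vector_derivative_at)
  then have r0: "r 0 = 0"
    using vd(1) norm_unit_dir[of \<theta>0] by (metis norm_zero scaleR_eq_0_iff zero_neq_one)
  \<comment> \<open>If \<open>d = 0\<close>, then \<open>r u\<close> is o(u), so the velocity of
    \<open>E\<close> is o(u) and \<open>E u - E 0\<close> is o(\<open>u^2\<close>), which a cusp
    excludes.\<close>
  have "d \<noteq> 0"
  proof
    assume "d = 0"
    then have "(r has_real_derivative 0) (at 0)"
      using eventually_nhds_x_imp_x[OF r] d by simp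
    then have r': "\<forall>e>0. \<exists>\<delta>>0. \<forall>u. norm (u - 0) < \<delta> \<longrightarrow> norm (r u - r 0 - 0 * (u - 0)) \<le> e * norm (u - 0)"
      unfolding has_field_derivative_def has_derivative_at_alt by blast
    have "\<forall>\<^sub>F u in nhds 0. norm (E u - E 0) \<le> \<epsilon> * u\<^sup>2" if "\<epsilon> > 0" for \<epsilon>
    proof (rule flat_if_derivative_flat[OF E])
      show "\<forall>\<^sub>F u in nhds 0. norm (r u *\<^sub>R unit_dir (u + \<theta>0)) \<le> \<epsilon> * \<bar>u\<bar>"
        using r' that r0 by (auto simp: eventually_nhds_metric)
    qed (use that in simp)
    then show False using three_halves_cusp_not_flat[OF assms(6)] by blast
  qed
  have E2: "(vderiv ^^ 2) E 0 = (d/2) *\<^sub>R unit_dir \<theta>0"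
    using vd(2) r0 d by simp
  have E3: "(vderiv ^^ 3) E 0 = r2 0 *\<^sub>R unit_dir \<theta>0 + d *\<^sub>R unit_dir (\<theta>0 + pi/2)"
    using vd(3) r0 d by simp
  have norm2: "norm ((vderiv ^^ 2) E 0) = \<bar>d/2\<bar>" by (simp add: E2)
  then have E2_nz: "(vderiv ^^ 2) E 0 \<noteq> 0" using \<open>d \<noteq> 0\<close> by auto
  \<comment> \<open>The second derivative of the radii enters \<open>E'''(0)\<close> only along the
    direction of \<open>E''(0)\<close>, so it does not affect the determinant.\<close>
  have det: "det2 ((vderiv ^^ 2) E 0) ((vderiv ^^ 3) E 0) = (d/2) * d"
    unfolding E2 E3 by (rule det2_unit_dir)
  have "det2 ((vderiv ^^ 2) E 0) ((vderiv ^^ 3) E 0) / norm ((vderiv ^^ 2) E 0) powr (5/2)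
      = 2 * sqrt 2 / sqrt \<bar>deriv \<Delta>\<rho> 0\<bar>"
    unfolding det norm2 curvature_quotient[OF \<open>d \<noteq> 0\<close>] by (simp only: d_def)
  then show ?thesis
    using E0 E2_nz by (simp only: cuspidal_curvature_def) blast
qed

end
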